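(* Let $K$ be a commutative, infinite idempotent semifield and let $p \in K[X]$ be a polynomial of degree $n > 0$. For $1 \leqslant k \leqslant n$ put $c_k := p_{n-k}\, p_{n-k+1}^{-1}$ if $p_{n-k+1} \neq 0$, and $c_k := 0$ otherwise. Then the following conditions are equivalent: (1) $p$ is closed; (2) $p$ splits in $K$; (3) $p$ has the concavity property; (4) $p$ has full support and $c_1 \geqslant \cdots \geqslant c_n$. If these conditions are satisfied, then $p(X) = p_n (X + c_1) \cdots (X + c_n)$, and the infimum of $\{ \widehat{p}(x) x^{-j} : x \in K^* \}$ is reached at $c_{n-j}$, i.e. $p_j^{\,j+1} = \widehat{p}(c_{n-j})\, p_{j+1}^{\,j}$, for every $0 \leqslant j < n$.
   Context: A semiring is a commutative monoid $(S,+,0)$ with an associative multiplication having identity $1$, distributing over $+$, and with $0$ absorbing. A semifield is a semiring with $1\neq 0$ in which every nonzero element has a multiplicative inverse; it is idempotent if $x+x=x$ for all $x$. All idempotent semifields are assumed commutative and infinite. An idempotent semifield $K$ is ordered by $x\leqslant y \iff x+y=y$; then $0$ is the least element, $x+y=x\vee y$ is the supremum of $\{x,y\}$, and $K$ is a lattice. $K^*=K\setminus\{0\}$, $\mathbb{N}$ contains $0$, and $x^0=1$ for all $x\in K$ (including $x=0$). A polynomial $p\in K[X]$ is a formal polynomial $p=\sum_{j\in\mathbb{N}}p_jX^j$, i.e. an eventually zero sequence $(p_j)_{j\in\mathbb{N}}$ of elements of $K$, with coefficientwise addition and Cauchy product. The support $\operatorname{supp}p$ is $\{j: p_j\neq0\}$;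 the degree $\deg p$ and valuation $\operatorname{val}p$ are its maximum and minimum. The polynomial function $\widehat p:K\to K$ is $\widehat p(x)=\sum_j p_jx^j$ (different formal polynomials may have the same function). The polynomial $p$ is closed if for every $j\in\mathbb{N}$ the set $\{\widehat p(x)x^{-j}:x\in K^*\}$ has an infimum in $K$ and this infimum equals $p_j$. A polynomial $p$ of degree $n>0$ splits in $K$ if $p(X)=p_n(X+r_1)\cdots(X+r_n)$ as formal polynomials for some $r_1,\dots,r_n\in K$. It has the concavity property if $p_j^{m_1+m_2}\geqslant p_{j_1}^{m_1}p_{j_2}^{m_2}$ for all $j,j_1,j_2,m_1,m_2\in\mathbb{N}$ with $(m_1+m_2)j=m_1j_1+m_2j_2$. It has full support if $\operatorname{supp}p=\{\operatorname{val}p,\operatorname{val}p+1,\dots,\deg p\}$. When $c_{n-j}=0$ (which is not in $K^*$), "reached at $c_{n-j}$" is to be understood as the displayed identity. *)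

theory Defs
  imports "HOL-Computational_Algebra.Polynomial" "HOL-Library.Lub_Glb"
begin

(* comm_semiring_1 already contains 0 \<noteq> 1.  The last two axioms about inverse and division
   fix the total operations in the same way as the class field does; they carry no content. *)
class idempotent_semifield = comm_semiring_1 + inverse + ord +
  assumes add_idem: "x + x = x"
    and left_inv: "x \<noteq> 0 \<Longrightarrow> inverse x * x = 1"
    and le_iff_add_absorb: "x \<le> y \<longleftrightarrow> x + y = y"
    and less_iff_le_neq: "x < y \<longleftrightarrow> x \<le> y \<and> x \<noteq> y"
    and inverse_of_zero: "inverse 0 = 0"
    and divide_eq_mult_inverse: "x / y = x * inverse y"
begin

subclass order
proof
  fix x y z :: 'a
  show "x \<le> x"
    by (simp add: le_iff_add_absorb add_idem)
  show anti: "x \<le> y \<Longrightarrow> y \<le> x \<Longrightarrow> x = y" for x y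
    by (metis le_iff_add_absorb add_commute)
  show "x \<le> y \<Longrightarrow> y \<le> z \<Longrightarrow> x \<le> z"
    by (metis le_iff_add_absorb add_assoc)
  show "x < y \<longleftrightarrow> x \<le> y \<and> \<not> y \<le> x"
    using anti by (auto simp: less_iff_le_neq)
qed

end

(* The infimum is taken in all of K, so 0 is an admissible lower bound and an admissible value. *)
definition closed_poly :: "'a::idempotent_semifield poly \<Rightarrow> bool" where
  "closed_poly p \<longleftrightarrow>
     (\<forall>j. isGlb UNIV {poly p x * inverse (x ^ j) | x. x \<noteq> 0} (coeff p j))"

(* Only meant for polynomials of positive degree.  [:r, 1:] is the polynomial X + r. *)
definition splits_poly :: "'a::idempotent_semifield poly \<Rightarrow> bool" where
  "splits_poly p \<longleftrightarrow>
     (\<exists>r :: nat \<Rightarrow> 'a. p = smult (coeff p (degree p)) (\<Prod>i = 1..degree p. [:r i, 1:]))"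

definition concavity_property :: "'a::idempotent_semifield poly \<Rightarrow> bool" where
  "concavity_property p \<longleftrightarrow>
     (\<forall>j j\<^sub>1 j\<^sub>2 m\<^sub>1 m\<^sub>2. (m\<^sub>1 + m\<^sub>2) * j = m\<^sub>1 * j\<^sub>1 + m\<^sub>2 * j\<^sub>2 \<longrightarrow>
        coeff p j ^ (m\<^sub>1 + m\<^sub>2) \<ge> coeff p j\<^sub>1 ^ m\<^sub>1 * coeff p j\<^sub>2 ^ m\<^sub>2)"

definition poly_support :: "'a::zero poly \<Rightarrow> nat set" where
  "poly_support p = {j. coeff p j \<noteq> 0}"

(* Unspecified for p = 0, whose support is empty. *)
definition poly_val :: "'a::zero poly \<Rightarrow> nat" where
  "poly_val p = Min (poly_support p)"

definition full_support :: "'a::zero poly \<Rightarrow> bool" where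
  "full_support p \<longleftrightarrow> poly_support p = {poly_val p..degree p}"

end

theory Submission
  imports Defs
begin

text \<open>
  Everything is compared with condition (4), in the division-free form
  \<open>p\<^sub>j p\<^sub>j\<^sub>+\<^sub>2 \<le> p\<^sub>j\<^sub>+\<^sub>1\<^sup>2\<close> together with full support. If \<open>p\<close> is closed, then every \<open>p\<^sub>i x\<^sup>i\<close> lies
  below the value of \<open>p\<close> at \<open>x\<close>, and passing to infima (which commute with powers because
  \<open>x\<^sup>m \<le> y\<^sup>m\<close> implies \<open>x \<le> y\<close>) gives concavity, hence (4). Conversely (4) makes \<open>p\<^sub>j x\<^sup>j\<close> the
  largest term of \<open>p\<close> at \<open>x = p\<^sub>j / p\<^sub>j\<^sub>+\<^sub>1\<close>, which yields both concavity and closedness; outside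
  the support one uses that an infinite semifield is unbounded. A product of linear factors is
  log-concave although its roots need not be comparable, while the \<open>c\<^sub>k\<close> in (4) form a chain, so
  that the \<open>k\<close>-th elementary symmetric function of them is \<open>c\<^sub>1 \<cdots> c\<^sub>k\<close>.
\<close>

section \<open>Idempotent semifields\<close>

context idempotent_semifield
begin

lemma right_inv: "x \<noteq> 0 \<Longrightarrow> x * inverse x = 1"
  using left_inv mult_commute by simp

lemma add_le_iff: "x + y \<le> z \<longleftrightarrow> x \<le> z \<and> y \<le> z"
proof
  assume "x + y \<le> z"
  then have h: "x + y + z = z"
    by (simp add: le_iff_add_absorb)
  have "x + z = x + (x + y + z)"
    using h by simp
  also have "\<dots> = x + x + y + z"
    by (simp only: add_assoc)
  also have "\<dots> = z"
    using h by (simp add: add_idem)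
  finally have "x \<le> z"
    by (simp add: le_iff_add_absorb)
  moreover have "y + z = y + (x + y + z)"
    using h by simp
  then have "y + z = x + (y + y) + z"
    by (metis add_assoc add_commute)
  then have "y \<le> z"
    using h by (simp add: le_iff_add_absorb add_idem)
  ultimately show "x \<le> z \<and> y \<le> z" ..
next
  assume "x \<le> z \<and> y \<le> z"
  then show "x + y \<le> z"
    by (simp add: le_iff_add_absorb add_assoc)
qed

\<comment> \<open>This and the instances after it make the library's results on ordered semirings,
  such as \<open>mult_mono\<close> and \<open>power_mono\<close>, applicable, with \<open>0\<close>
  as least element.\<close>
subclass canonically_ordered_monoid_add
proof
  fix a b
  show "a \<le> b \<longleftrightarrow> (\<exists>c. b = a + c)"
    by (metis add_le_iff le_iff_add_absorb order_refl)
qed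

subclass ordered_comm_semiring
proof
  fix a b c
  show "a \<le> b \<Longrightarrow> c * a \<le> c * b"
    by (metis distrib_left le_iff_add_absorb)
qed

subclass semiring_1_no_zero_divisors
proof
  fix a b
  assume "a \<noteq> 0" "b \<noteq> 0"
  then show "a * b \<noteq> 0"
    by (metis left_inv mult_assoc mult_1_left mult_zero_right)
qed

subclass ordered_semiring_1
  by standard (simp add: less_iff_le_neq)

end

section \<open>Cancellation, roots and unboundedness\<close>

lemma sum_le_iff:
  fixes f :: "'b \<Rightarrow> 'a::idempotent_semifield"
  assumes "finite A"
  shows "sum f A \<le> z \<longleftrightarrow> (\<forall>a\<in>A. f a \<le> z)"
  using assms by (induction A rule: finite_induct) (auto simp: add_le_iff)

lemma mult_mono_semifield:
  fixes a b c d :: "'a::idempotent_semifield"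
  shows "a \<le> b \<Longrightarrow> c \<le> d \<Longrightarrow> a * c \<le> b * d"
  by (simp add: mult_mono)

lemma power_mono_semifield:
  fixes a b :: "'a::idempotent_semifield"
  shows "a \<le> b \<Longrightarrow> a ^ n \<le> b ^ n"
  by (simp add: power_mono)

lemma inverse_nonzero:
  fixes a :: "'a::idempotent_semifield"
  shows "a \<noteq> 0 \<Longrightarrow> inverse a \<noteq> 0"
  using left_inv by force

lemma mult_le_cancel_semifield:
  fixes a b c :: "'a::idempotent_semifield"
  assumes "c \<noteq> 0"
  shows "a * c \<le> b * c \<longleftrightarrow> a \<le> b"
proof
  assume "a * c \<le> b * c"
  then have "a * c * inverse c \<le> b * c * inverse c"
    by (simp add: mult_mono)
  then show "a \<le> b"
    using assms by (simp add: mult.assoc right_inv)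
qed (simp add: mult_mono)

lemma le_mult_inverse_iff:
  fixes a b c :: "'a::idempotent_semifield"
  assumes "c \<noteq> 0"
  shows "a \<le> b * inverse c \<longleftrightarrow> a * c \<le> b"
  using mult_le_cancel_semifield[OF assms, of a "b * inverse c"] assms
  by (simp add: mult.assoc left_inv)

text \<open>Multiplying \<open>1 + x + \<dots> + x ^ n\<close> by \<open>x\<close> replaces the summand \<open>1\<close> by \<open>x ^ Suc n\<close>.\<close>
lemma power_le_one_imp_le_one:
  fixes x :: "'a::idempotent_semifield"
  assumes "x ^ Suc n \<le> 1"
  shows "x \<le> 1"
proof -
  define u where "u = (\<Sum>i\<le>n. x ^ i)"
  have le_u: "x ^ i \<le> u" if "i \<le> n" for i
    using sum_le_iff[of "{..n}" "\<lambda>i. x ^ i" u] that by (simp add: u_def)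
  have "1 \<le> u"
    using le_u[of 0] by simp
  then have "u \<noteq> 0"
    by auto
  have "x * x ^ i \<le> u" if "i \<le> n" for i
  proof (cases "i = n")
    case True
    then show ?thesis
      using assms \<open>1 \<le> u\<close> by simp
  next
    case False
    then show ?thesis
      using le_u[of "Suc i"] that by simp
  qed
  then have "x * u \<le> 1 * u"
    by (simp add: u_def sum_distrib_left sum_le_iff)
  then show ?thesis
    using \<open>u \<noteq> 0\<close> mult_le_cancel_semifield by blast
qed

lemma power_le_imp_le_semifield:
  fixes x y :: "'a::idempotent_semifield"
  assumes "x ^ n \<le> y ^ n" "n > 0"
  shows "x \<le> y"
proof (cases "y = 0")
  case True
  then show ?thesis
    using assms by (simp add: zero_power)
next
  case False
  obtain m where m: "n = Suc m"
    using assms(2) gr0_implies_Suc by blast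
  have "(x * inverse y) ^ n \<le> (y * inverse y) ^ n"
    using assms(1) by (simp add: power_mult_distrib mult_mono)
  then have "x * inverse y \<le> 1"
    using False m power_le_one_imp_le_one by (simp add: right_inv)
  then have "x * inverse y * y \<le> 1 * y"
    by (rule mult_right_mono) simp
  then show ?thesis
    using False by (simp add: mult.assoc left_inv)
qed

text \<open>If nothing exceeds \<open>1\<close>, then \<open>1 + y = 1\<close> bounds every element
  by \<open>1\<close>, and inverses turn this around for nonzero elements, so that only
  \<open>0\<close> and \<open>1\<close> remain. The infinitude of the semifield enters through this
  lemma alone.\<close>

lemma exists_gt_one:
  assumes "infinite (UNIV :: 'a::idempotent_semifield set)"
  shows "\<exists>g::'a. 1 < g"
proof (rule ccontr)
  assume *: "\<not> ?thesis"
  have "x \<in> {0, 1}" for x :: 'a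
  proof -
    have le: "y \<le> 1" for y :: 'a
      using * add_le_iff[of 1 y "1 + y"] by (metis order.not_eq_order_implies_strict order_refl)
    have "1 \<le> x" if "x \<noteq> 0"
      using le[of "inverse x"] mult_right_mono[of "inverse x" 1 x] that by (simp add: left_inv)
    then show ?thesis
      using le[of x] by (auto intro: antisym)
  qed
  then have "UNIV \<subseteq> {0, 1 :: 'a}"
    by blast
  then show False
    using assms finite_subset by blast
qed

section \<open>Infima of multiples and powers\<close>

lemma isGlb_UNIV_iff:
  "isGlb UNIV S g \<longleftrightarrow> (\<forall>s\<in>S. g \<le> s) \<and> (\<forall>y. (\<forall>s\<in>S. y \<le> s) \<longrightarrow> y \<le> g)"
  by (auto simp: isGlb_def greatestP_def isLb_def setle_def setge_def)

text \<open>Multiplication by a nonzero \<open>c\<close> is an order automorphism and so preserves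
  infima. For \<open>c = 0\<close>, any element of \<open>S\<close> already gives
  \<open>y \<le> 0\<close>.\<close>

lemma le_mult_Glb:
  fixes y :: "'a::idempotent_semifield"
  assumes "isGlb UNIV S g" "S \<noteq> {}" "\<And>s. s \<in> S \<Longrightarrow> y \<le> c * s"
  shows "y \<le> c * g"
proof (cases "c = 0")
  case True
  then show ?thesis
    using assms by auto
next
  case False
  have "y * inverse c \<le> s" if "s \<in> S" for s
  proof -
    have "y * inverse c * c = y"
      using False by (simp add: mult.assoc left_inv)
    then have "y * inverse c * c \<le> s * c"
      using assms(3)[OF that] by (simp add: mult.commute)
    then show ?thesis
      using False mult_le_cancel_semifield by blast
  qed
  then have "y * inverse c \<le> g"
    using assms(1) by (simp add: isGlb_UNIV_iff)
  then have "y * inverse c * c \<le> g * c"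
    by (rule mult_right_mono) simp
  then show ?thesis
    using False by (simp add: mult.assoc left_inv mult.commute[of c])
qed

text \<open>The set \<open>S\<close> need not be directed, so mixed products have to be compared with pure powers;
  this is done by taking \<open>m\<close>-th roots.\<close>
lemma le_power_Glb:
  fixes y :: "'a::idempotent_semifield"
  assumes S: "isGlb UNIV S g" "S \<noteq> {}" and y: "\<And>s. s \<in> S \<Longrightarrow> y \<le> s ^ m"
  shows "y \<le> g ^ m"
proof -
  \<comment> \<open>The \<open>m\<close> factors \<open>s\<close> are exchanged for \<open>g\<close>
    one at a time; \<open>k\<close> counts those already exchanged.\<close>
  have "\<forall>s\<in>S. y \<le> g ^ k * s ^ l" if "k + l = m" for k l
    using that
  proof (induction k arbitrary: l)
    case 0
    then show ?case
      using y by simp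
  next
    case (Suc k)
    then have IH: "y \<le> g ^ k * s ^ Suc l" if "s \<in> S" for s
      using that by (metis add_Suc_shift)
    show ?case
    proof
      fix b
      assume b: "b \<in> S"
      have "y \<le> (g ^ k * b ^ l) * a" if a: "a \<in> S" for a
      proof (rule power_le_imp_le_semifield)
        \<comment> \<open>One factor \<open>y\<close> is bounded through \<open>a\<close> and the
          other \<open>l\<close> through \<open>b\<close>; the exponents then combine to an exact
          power. With \<open>b\<close> fixed, the infimum over \<open>a\<close> produces the next
          \<open>g\<close>.\<close>
        have "y ^ Suc l = y * y ^ l"
          by simp
        also have "\<dots> \<le> (g ^ k * a ^ Suc l) * (g ^ k * b ^ Suc l) ^ l"
          by (intro mult_mono_semifield power_mono_semifield IH a b)
        also have "\<dots> = ((g ^ k * b ^ l) * a) ^ Suc l"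
          by (simp add: power_mult_distrib power_mult[symmetric] power_add ac_simps)
        finally show "y ^ Suc l \<le> ((g ^ k * b ^ l) * a) ^ Suc l" .
      qed simp
      then have "y \<le> (g ^ k * b ^ l) * g"
        using le_mult_Glb[OF S] by blast
      then show "y \<le> g ^ Suc k * b ^ l"
        by (simp add: ac_simps)
    qed
  qed
  from this[of m 0] show ?thesis
    using S(2) by auto
qed

section \<open>Polynomials over idempotent semifields\<close>

lemma coeff_le_poly:
  fixes p :: "'a::idempotent_semifield poly"
  shows "coeff p j * x ^ j \<le> poly p x"
proof (cases "j \<le> degree p")
  case True
  have "(\<Sum>i\<le>degree p. coeff p i * x ^ i) \<le> poly p x"
    by (simp add: poly_altdef)
  then show ?thesis
    using True by (subst (asm) sum_le_iff) auto
next
  case False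
  then show ?thesis
    by (simp add: coeff_eq_0)
qed

lemma poly_le_iff:
  fixes p :: "'a::idempotent_semifield poly"
  shows "poly p x \<le> z \<longleftrightarrow> (\<forall>i. coeff p i * x ^ i \<le> z)"
proof
  assume "poly p x \<le> z"
  then show "\<forall>i. coeff p i * x ^ i \<le> z"
    using coeff_le_poly order_trans by blast
qed (simp add: poly_altdef sum_le_iff)

section \<open>From closedness to concavity\<close>

definition poly_quotients :: "'a::idempotent_semifield poly \<Rightarrow> nat \<Rightarrow> 'a set" where
  "poly_quotients p j = {poly p x * inverse (x ^ j) | x. x \<noteq> 0}"

lemma poly_quotients_nonempty: "poly_quotients p j \<noteq> {}"
proof -
  have "poly p 1 * inverse (1 ^ j) \<in> poly_quotients p j"
    unfolding poly_quotients_def by (intro CollectI exI[of _ 1]) simp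
  then show ?thesis
    by blast
qed

lemma le_poly_quotients_iff:
  "(\<forall>s\<in>poly_quotients p j. b \<le> s) \<longleftrightarrow> (\<forall>x. x \<noteq> 0 \<longrightarrow> b * x ^ j \<le> poly p x)"
  by (auto simp: poly_quotients_def le_mult_inverse_iff)

text \<open>That \<open>coeff p j\<close> is a lower bound is automatic, so only its being the
  greatest one has content; denominators are cleared.\<close>

lemma isGlb_poly_quotients_iff:
  "isGlb UNIV (poly_quotients p j) (coeff p j) \<longleftrightarrow>
     (\<forall>b. (\<forall>x. x \<noteq> 0 \<longrightarrow> b * x ^ j \<le> poly p x) \<longrightarrow> b \<le> coeff p j)"
  by (simp add: isGlb_UNIV_iff le_poly_quotients_iff coeff_le_poly)

lemma closed_imp_concavity:
  fixes p :: "'a::idempotent_semifield poly"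
  assumes "closed_poly p"
  shows "concavity_property p"
  unfolding concavity_property_def
proof (intro allI impI)
  fix j j1 j2 m1 m2 :: nat
  assume eq: "(m1 + m2) * j = m1 * j1 + m2 * j2"
  have "isGlb UNIV (poly_quotients p j) (coeff p j)"
    using assms by (simp add: closed_poly_def poly_quotients_def)
  moreover have "coeff p j1 ^ m1 * coeff p j2 ^ m2 \<le> s ^ (m1 + m2)"
    if s: "s \<in> poly_quotients p j" for s
  proof -
    obtain x where x: "x \<noteq> 0" "s = poly p x * inverse (x ^ j)"
      using s by (auto simp: poly_quotients_def)
    then have "s * x ^ j = poly p x"
      by (simp add: mult.assoc left_inv)
    then have le: "coeff p i * x ^ i \<le> s * x ^ j" for i
      using coeff_le_poly by metis
    \<comment> \<open>By \<open>eq\<close> the exponents of \<open>x\<close> agree on both sides, so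
      \<open>x\<close> cancels and a bound on \<open>s ^ (m1 + m2)\<close> alone remains.\<close>
    have "(coeff p j1 ^ m1 * coeff p j2 ^ m2) * x ^ (m1 * j1 + m2 * j2)
        = (coeff p j1 * x ^ j1) ^ m1 * (coeff p j2 * x ^ j2) ^ m2"
      by (simp add: power_mult_distrib power_add power_mult[symmetric] ac_simps)
    also have "\<dots> \<le> (s * x ^ j) ^ m1 * (s * x ^ j) ^ m2"
      by (intro mult_mono_semifield power_mono_semifield le)
    also have "\<dots> = (s * x ^ j) ^ (m1 + m2)"
      by (simp only: power_add)
    also have "\<dots> = s ^ (m1 + m2) * x ^ (m1 * j1 + m2 * j2)"
      by (simp only: power_mult_distrib power_mult[symmetric] mult.commute[of j] eq)
    finally show ?thesis
      using mult_le_cancel_semifield x(1) by (metis power_not_zero)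
  qed
  ultimately show "coeff p j1 ^ m1 * coeff p j2 ^ m2 \<le> coeff p j ^ (m1 + m2)"
    using le_power_Glb poly_quotients_nonempty by blast
qed

section \<open>Full support, ratios and maximal terms\<close>

lemma finite_poly_support: "finite (poly_support p)"
proof -
  have "poly_support p \<subseteq> {..degree p}"
    by (auto simp: poly_support_def le_degree)
  then show ?thesis
    using finite_subset by blast
qed

text \<open>The minimum in \<open>poly_val\<close> is traded for the absence of gaps below the
  degree, the form in which full support is used below.\<close>

lemma full_support_iff:
  assumes "p \<noteq> 0"
  shows "full_support p \<longleftrightarrow>
    (\<forall>i j. coeff p i \<noteq> 0 \<and> i \<le> j \<and> j \<le> degree p \<longrightarrow> coeff p j \<noteq> 0)"
proof
  assume "full_support p"
  then have s: "coeff p j \<noteq> 0 \<longleftrightarrow> poly_val p \<le> j \<and> j \<le> degree p" for j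
    by (auto simp: full_support_def poly_support_def set_eq_iff)
  then show "\<forall>i j. coeff p i \<noteq> 0 \<and> i \<le> j \<and> j \<le> degree p \<longrightarrow> coeff p j \<noteq> 0"
    using order_trans by blast
next
  assume R: "\<forall>i j. coeff p i \<noteq> 0 \<and> i \<le> j \<and> j \<le> degree p \<longrightarrow> coeff p j \<noteq> 0"
  have "degree p \<in> poly_support p"
    using assms by (simp add: poly_support_def)
  then have "poly_val p \<in> poly_support p"
    unfolding poly_val_def by (intro Min_in finite_poly_support) auto
  moreover have "poly_val p \<le> j" if "j \<in> poly_support p" for j
    unfolding poly_val_def using that by (intro Min_le finite_poly_support)
  moreover have "j \<in> poly_support p" if "poly_val p \<le> j" "j \<le> degree p" for j
    using R that calculation(1) unfolding poly_support_def by blast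
  ultimately show "full_support p"
    unfolding full_support_def by (auto simp: poly_support_def intro: le_degree)
qed

text \<open>Consecutive quotients of coefficients are compared by cross multiplication. Ranging over
  all \<open>j\<close> is harmless, since the left side vanishes once \<open>j + 2\<close> exceeds
  the degree.\<close>

definition ratio_condition :: "'a::idempotent_semifield poly \<Rightarrow> bool" where
  "ratio_condition p \<longleftrightarrow> full_support p \<and>
     (\<forall>j. coeff p j * coeff p (j + 2) \<le> coeff p (j + 1) * coeff p (j + 1))"

lemma concavity_imp_ratio:
  fixes p :: "'a::idempotent_semifield poly"
  assumes "concavity_property p" "p \<noteq> 0"
  shows "ratio_condition p"
proof -
  have C: "coeff p j1 ^ m1 * coeff p j2 ^ m2 \<le> coeff p j ^ (m1 + m2)"
    if "(m1 + m2) * j = m1 * j1 + m2 * j2" for j j1 j2 m1 m2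
    using assms(1) that by (auto simp: concavity_property_def)
  have "coeff p j \<noteq> 0" if ij: "coeff p i \<noteq> 0" "i \<le> j" "j \<le> degree p" for i j
  proof
    assume j: "coeff p j = 0"
    then have "i < j" "j < degree p"
      using ij assms(2) by (metis order.order_iff_strict leading_coeff_0_iff)+
    then obtain a b where ab: "j = i + Suc a" "degree p = j + b"
      by (metis less_iff_Suc_add add_Suc_right less_imp_le le_Suc_ex)
    \<comment> \<open>The weights are the distances from \<open>j\<close> to the degree and to
      \<open>i\<close>, which makes \<open>j\<close> the weighted mean of these two indices. The
      exponent on the right is positive, so the right side is \<open>0\<close>.\<close>
    have "coeff p i ^ b * lead_coeff p ^ Suc a \<le> coeff p j ^ (b + Suc a)"
      by (rule C) (simp add: ab algebra_simps)
    then show False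
      using j ij(1) assms(2) by simp
  qed
  moreover have "coeff p j * coeff p (j + 2) \<le> coeff p (j + 1) * coeff p (j + 1)" for j
    using C[of 1 1 "j + 1" j "j + 2"] by (simp add: numeral_2_eq_2)
  ultimately show ?thesis
    unfolding ratio_condition_def full_support_iff[OF assms(2)] by blast
qed

text \<open>If \<open>p\<^sub>j\<close> and \<open>p\<^sub>j\<^sub>+\<^sub>1\<close> are nonzero, the terms of \<open>p\<close> at \<open>e = p\<^sub>j / p\<^sub>j\<^sub>+\<^sub>1\<close> increase up to
  index \<open>j\<close> and decrease from index \<open>j + 1\<close> on.\<close>
lemma ratio_imp_maximal_term:
  fixes p :: "'a::idempotent_semifield poly"
  assumes R: "ratio_condition p" and j: "coeff p j \<noteq> 0" "j < degree p"
  defines "e \<equiv> coeff p j * inverse (coeff p (j + 1))"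
  shows "poly p e = coeff p j * e ^ j"
proof -
  have "p \<noteq> 0"
    using j by auto
  then have F: "coeff p i \<noteq> 0 \<Longrightarrow> i \<le> k \<Longrightarrow> k \<le> degree p \<Longrightarrow> coeff p k \<noteq> 0" for i k
    using R by (metis ratio_condition_def full_support_iff)
  have L: "coeff p i * coeff p (i + 2) \<le> coeff p (i + 1) * coeff p (i + 1)" for i
    using R by (simp add: ratio_condition_def)
  have nz: "coeff p (j + 1) \<noteq> 0"
    using F[of j "j + 1"] j by simp
  have "e \<noteq> 0"
    using j nz by (simp add: e_def inverse_nonzero)
  have e: "e * coeff p (j + 1) = coeff p j"
    using nz by (simp add: e_def mult.assoc left_inv)
  have cancel: "coeff p i \<le> coeff p (i + 1) * e"
    if "coeff p i * coeff p (j + 1) \<le> coeff p (i + 1) * coeff p j" for i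
    using that mult_le_cancel_semifield[OF nz, of "coeff p i" "coeff p (i + 1) * e"] e
    by (simp add: mult.assoc)
  \<comment> \<open>The quotients of consecutive coefficients are at most \<open>e\<close> up to
    \<open>j\<close>. In the induction, the local inequality times the hypothesis is the claim times
    a factor that full support makes nonzero.\<close>
  have up: "coeff p i * coeff p (j + 1) \<le> coeff p (i + 1) * coeff p j" if "i \<le> j" for i
    using that
  proof (induction "j - i" arbitrary: i)
    case 0
    then show ?case
      by (simp add: mult.commute)
  next
    case (Suc d)
    show ?case
    proof (cases "coeff p i = 0")
      case False
      then have nz2: "coeff p (i + 2) \<noteq> 0"
        using F[of i "i + 2"] Suc.hyps(2) j by simp
      have nz1: "coeff p (i + 1) \<noteq> 0"
        using F[of i "i + 1"] Suc.hyps(2) j False by simp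
      have IH: "coeff p (i + 1) * coeff p (j + 1) \<le> coeff p (i + 2) * coeff p j"
        using Suc.hyps(1)[of "i + 1"] Suc.hyps(2) by simp
      have "(coeff p i * coeff p (j + 1)) * (coeff p (i + 1) * coeff p (i + 2))
          = (coeff p i * coeff p (i + 2)) * (coeff p (i + 1) * coeff p (j + 1))"
        by (simp only: ac_simps)
      also have "\<dots> \<le> (coeff p (i + 1) * coeff p (i + 1)) * (coeff p (i + 2) * coeff p j)"
        by (intro mult_mono_semifield L IH)
      also have "\<dots> = (coeff p (i + 1) * coeff p j) * (coeff p (i + 1) * coeff p (i + 2))"
        by (simp only: ac_simps)
      finally show ?thesis
        using mult_le_cancel_semifield nz1 nz2 by (metis mult_eq_0_iff)
    qed simp
  qed
  \<comment> \<open>Symmetrically, the quotients are at least \<open>e\<close> from \<open>j\<close>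
    on; a vanishing numerator makes the left side \<open>0\<close>.\<close>
  have down: "coeff p (i + 1) * coeff p j \<le> coeff p i * coeff p (j + 1)" if "j \<le> i" for i
    using that
  proof (induction i rule: dec_induct)
    case base
    then show ?case
      by (simp add: mult.commute)
  next
    case (step i)
    show ?case
    proof (cases "coeff p (i + 2) = 0")
      case False
      then have "i + 2 \<le> degree p"
        by (rule le_degree)
      then have nz: "coeff p i \<noteq> 0" "coeff p (i + 1) \<noteq> 0"
        using F[of j i] F[of j "i + 1"] j step.hyps by auto
      have "(coeff p (i + 2) * coeff p j) * (coeff p i * coeff p (i + 1))
          = (coeff p i * coeff p (i + 2)) * (coeff p (i + 1) * coeff p j)"
        by (simp only: ac_simps)
      also have "\<dots> \<le> (coeff p (i + 1) * coeff p (i + 1)) * (coeff p i * coeff p (j + 1))"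
        by (intro mult_mono_semifield L step.IH)
      also have "\<dots> = (coeff p (i + 1) * coeff p (j + 1)) * (coeff p i * coeff p (i + 1))"
        by (simp only: ac_simps)
      finally show ?thesis
        using mult_le_cancel_semifield nz by (metis mult_eq_0_iff add_2_eq_Suc' Suc_eq_plus1)
    qed simp
  qed
  have below: "coeff p i * e ^ i \<le> coeff p j * e ^ j" if "i \<le> j" for i
    using that
  proof (induction rule: inc_induct)
    case (step k)
    have "coeff p k * e ^ k \<le> coeff p (k + 1) * e * e ^ k"
      using up[of k] cancel[of k] step.hyps by (simp add: mult_right_mono)
    then show ?case
      using step.IH by (simp add: mult.assoc)
  qed simp
  have above: "coeff p i * e ^ i \<le> coeff p j * e ^ j" if "j \<le> i" for i
    using that
  proof (induction i rule: dec_induct)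
    case (step k)
    have "coeff p (k + 1) * e * coeff p (j + 1) \<le> coeff p k * coeff p (j + 1)"
      using down[OF step.hyps(1)] e by (simp add: mult.assoc)
    then have "coeff p (k + 1) * e \<le> coeff p k"
      using mult_le_cancel_semifield nz by blast
    then have "coeff p (k + 1) * e * e ^ k \<le> coeff p k * e ^ k"
      by (simp add: mult_right_mono)
    then show ?case
      using step.IH by (simp add: mult.assoc)
  qed simp
  show ?thesis
  proof (rule antisym)
    show "poly p e \<le> coeff p j * e ^ j"
      using below above nat_le_linear by (auto simp: poly_le_iff)
  qed (rule coeff_le_poly)
qed

lemma exists_maximal_lead_term:
  fixes p :: "'a::idempotent_semifield poly"
  assumes "p \<noteq> 0"
  shows "\<exists>e. e \<noteq> 0 \<and> poly p e = lead_coeff p * e ^ degree p"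
proof -
  define n where "n = degree p"
  define s where "s = (\<Sum>i\<le>n. coeff p i)"
  \<comment> \<open>The top index has no quotient to evaluate at, so a large point is taken. Of the
    extra factors \<open>e\<close> in the leading term, one absorbs the coefficient because
    \<open>s \<le> e * coeff p n\<close>; the others are at least \<open>1\<close>.\<close>
  define e where "e = 1 + s * inverse (coeff p n)"
  have nz: "coeff p n \<noteq> 0"
    using assms by (simp add: n_def)
  have e: "1 \<le> e" "s * inverse (coeff p n) \<le> e"
    using add_le_iff[of 1 "s * inverse (coeff p n)" e] by (simp_all add: e_def)
  then have "e \<noteq> 0"
    by auto
  have "coeff p i * e ^ i \<le> coeff p n * e ^ n" if "i \<le> n" for i
  proof (cases "i = n")
    case False
    then have "i < n"
      using that by simp
    then obtain d where "n = Suc (i + d)"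
      using less_imp_Suc_add by blast
    then have d: "n = i + Suc d"
      by simp
    have "coeff p i \<le> s"
      using sum_le_iff[of "{..n}" "coeff p" s] that by (simp add: s_def)
    also have "s = s * inverse (coeff p n) * coeff p n"
      using nz by (simp add: mult.assoc left_inv)
    also have "\<dots> \<le> e * coeff p n"
      using e(2) by (simp add: mult_right_mono)
    also have "\<dots> * 1 ^ d \<le> e * coeff p n * e ^ d"
      using e(1) by (intro mult_mono_semifield power_mono_semifield) simp_all
    finally have "coeff p i * e ^ i \<le> e * coeff p n * e ^ d * e ^ i"
      by (simp add: mult_right_mono)
    then show ?thesis
      by (simp add: d power_add ac_simps)
  qed simp
  then have "poly p e \<le> coeff p n * e ^ n"
    by (simp add: poly_altdef n_def sum_le_iff)
  then show ?thesis
    using \<open>e \<noteq> 0\<close> coeff_le_poly[of p n e] unfolding n_def by (metis antisym)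
qed

text \<open>Inside the support, this is all that concavity and closedness need.\<close>

lemma ratio_imp_exists_maximal_term:
  fixes p :: "'a::idempotent_semifield poly"
  assumes "ratio_condition p" "coeff p j \<noteq> 0"
  shows "\<exists>e. e \<noteq> 0 \<and> poly p e = coeff p j * e ^ j"
proof (cases "j = degree p")
  case True
  then show ?thesis
    using exists_maximal_lead_term assms(2) by fastforce
next
  case False
  then have j: "j < degree p"
    using assms(2) le_degree le_neq_implies_less by blast
  moreover have "p \<noteq> 0"
    using assms(2) by auto
  ultimately have "coeff p (j + 1) \<noteq> 0"
    using assms full_support_iff[of p] unfolding ratio_condition_def
    by (metis Suc_eq_plus1 Suc_leI le_add1)
  then show ?thesis
    using ratio_imp_maximal_term[OF assms j] assms(2) inverse_nonzero by (metis mult_eq_0_iff)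
qed

section \<open>Concavity and closedness from the ratio condition\<close>

text \<open>At a point where the term of index \<open>j\<close> is maximal, the inequality holds
  term by term and the point cancels. If \<open>coeff p j = 0\<close> but the left side is nonzero,
  the weighted mean \<open>j\<close> lies between indices of nonzero coefficients, contradicting
  full support.\<close>

lemma ratio_imp_concavity:
  fixes p :: "'a::idempotent_semifield poly"
  assumes R: "ratio_condition p" "p \<noteq> 0"
  shows "concavity_property p"
  unfolding concavity_property_def
proof (intro allI impI)
  fix j j1 j2 m1 m2 :: nat
  assume eq: "(m1 + m2) * j = m1 * j1 + m2 * j2"
  show "coeff p j1 ^ m1 * coeff p j2 ^ m2 \<le> coeff p j ^ (m1 + m2)"
  proof (cases "coeff p j = 0")
    case False
    then obtain e where e: "e \<noteq> 0" "poly p e = coeff p j * e ^ j"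
      using ratio_imp_exists_maximal_term[OF R(1)] by blast
    then have le: "coeff p i * e ^ i \<le> coeff p j * e ^ j" for i
      using coeff_le_poly by metis
    have "(coeff p j1 ^ m1 * coeff p j2 ^ m2) * e ^ (m1 * j1 + m2 * j2)
        = (coeff p j1 * e ^ j1) ^ m1 * (coeff p j2 * e ^ j2) ^ m2"
      by (simp add: power_mult_distrib power_add power_mult[symmetric] ac_simps)
    also have "\<dots> \<le> (coeff p j * e ^ j) ^ m1 * (coeff p j * e ^ j) ^ m2"
      by (intro mult_mono_semifield power_mono_semifield le)
    also have "\<dots> = (coeff p j * e ^ j) ^ (m1 + m2)"
      by (simp only: power_add)
    also have "\<dots> = coeff p j ^ (m1 + m2) * e ^ (m1 * j1 + m2 * j2)"
      by (simp only: power_mult_distrib power_mult[symmetric] mult.commute[of j] eq)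
    finally show ?thesis
      using mult_le_cancel_semifield e(1) by (metis power_not_zero)
  next
    case True
    show ?thesis
    proof (rule ccontr)
      assume neg: "\<not> ?thesis"
      then have "coeff p j1 ^ m1 * coeff p j2 ^ m2 \<noteq> 0"
        using zero_le by metis
      then have nz: "m1 = 0 \<or> coeff p j1 \<noteq> 0" "m2 = 0 \<or> coeff p j2 \<noteq> 0"
        by auto
      \<comment> \<open>With both weights zero, each side is \<open>1\<close> and the inequality
        would hold.\<close>
      have m: "m1 + m2 > 0"
        using neg by (metis add_is_0 mult_1 order_refl power_0 neq0_conv)
      have "\<exists>i\<le>j. coeff p i \<noteq> 0"
      proof (rule ccontr)
        assume "\<not> ?thesis"
        then have a: "m1 = 0 \<or> j < j1" "m2 = 0 \<or> j < j2"
          using nz not_le by blast+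
        then have "m1 * j \<le> m1 * j1" "m2 * j \<le> m2 * j2"
          by auto
        moreover have "m1 * j < m1 * j1 \<or> m2 * j < m2 * j2"
          using a m by auto
        ultimately have "(m1 + m2) * j < m1 * j1 + m2 * j2"
          unfolding add_mult_distrib by linarith
        then show False
          using eq by simp
      qed
      moreover have "j \<le> degree p"
      proof (rule ccontr)
        assume "\<not> ?thesis"
        then have a: "m1 = 0 \<or> j1 < j" "m2 = 0 \<or> j2 < j"
          using nz le_degree[of p j1] le_degree[of p j2] by linarith+
        then have "m1 * j1 \<le> m1 * j" "m2 * j2 \<le> m2 * j"
          by auto
        moreover have "m1 * j1 < m1 * j \<or> m2 * j2 < m2 * j"
          using a m by auto
        ultimately have "m1 * j1 + m2 * j2 < (m1 + m2) * j"
          unfolding add_mult_distrib by linarith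
        then show False
          using eq by simp
      qed
      ultimately show False
        using R True full_support_iff unfolding ratio_condition_def by blast
    qed
  qed
qed

text \<open>Inside the support, a lower bound \<open>b\<close> is tested at a point where the term
  of index \<open>j\<close> is maximal. Outside it, testing at large or small points gives
  \<open>b * x \<le> s\<close> for all \<open>x \<ge> 1\<close>, which forces
  \<open>b = 0\<close>.\<close>

lemma ratio_imp_closed:
  fixes p :: "'a::idempotent_semifield poly"
  assumes inf: "infinite (UNIV :: 'a set)" and R: "ratio_condition p" "p \<noteq> 0"
  shows "closed_poly p"
proof -
  obtain g :: 'a where g: "1 < g"
    using exists_gt_one[OF inf] by blast
  \<comment> \<open>If \<open>y\<close> bounded all elements above \<open>1\<close>, it would bound
    \<open>(1 + y) * g\<close>, and cancelling \<open>1 + y\<close> would give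
    \<open>g \<le> 1\<close>.\<close>
  have unbounded: "\<exists>x\<ge>1. \<not> x \<le> y" for y :: 'a
  proof (rule ccontr)
    assume *: "\<not> ?thesis"
    have z: "1 \<le> 1 + y"
      using add_le_iff[of 1 y "1 + y"] by simp
    then have "(1 + y) * 1 \<le> (1 + y) * g"
      using g by (intro mult_mono_semifield) auto
    then have "(1 + y) * g \<le> y"
      using * z by (metis mult_1_right order_trans)
    also have "y \<le> (1 + y) * 1"
      using add_le_iff[of 1 y "1 + y"] by simp
    finally have "g \<le> 1"
      using z mult_le_cancel_semifield[of "1 + y" g 1] by (auto simp: mult.commute)
    then show False
      using g by simp
  qed
  define s where "s = (\<Sum>i\<le>degree p. coeff p i)"
  have s: "coeff p i \<le> s" for i
    using sum_le_iff[of "{..degree p}" "coeff p" s]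
    by (cases "i \<le> degree p") (simp_all add: s_def coeff_eq_0)
  have "b \<le> coeff p j" if b: "\<And>x. x \<noteq> 0 \<Longrightarrow> b * x ^ j \<le> poly p x" for b j
  proof (cases "coeff p j = 0")
    case False
    then obtain e where e: "e \<noteq> 0" "poly p e = coeff p j * e ^ j"
      using ratio_imp_exists_maximal_term[OF R(1)] by blast
    then show ?thesis
      using b[OF e(1)] mult_le_cancel_semifield by (metis power_not_zero)
  next
    case True
    have bound: "b * x \<le> s" if x: "1 \<le> x" for x
    proof -
      have xnz: "x \<noteq> 0"
        using x by auto
      have mono: "x ^ i \<le> x ^ k" if "i \<le> k" for i k
        using mult_mono_semifield[OF order_refl[of "x ^ i"] power_mono_semifield[OF x, of "k - i"]]
          that by (simp add: power_add[symmetric])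
      consider "degree p < j" | "\<And>i. i \<le> j \<Longrightarrow> coeff p i = 0"
        using True R full_support_iff unfolding ratio_condition_def by (metis not_le)
      then show ?thesis
      proof cases
        case 1
        \<comment> \<open>All exponents occurring in \<open>p\<close> are at most
          \<open>j - 1\<close>, so one factor \<open>x\<close> is left over on the side of
          \<open>b\<close>.\<close>
        then obtain k where k: "j = Suc k"
          using gr0_implies_Suc by (metis not_less_zero not0_implies_Suc)
        have "coeff p i * x ^ i \<le> s * x ^ k" for i
        proof (cases "i \<le> k")
          case True
          then show ?thesis
            by (intro mult_mono_semifield s mono)
        next
          case False
          then show ?thesis
            using 1 k by (simp add: coeff_eq_0)
        qed
        then have "b * x ^ j \<le> s * x ^ k"
          using order_trans[OF b[OF xnz]] poly_le_iff by blast
        then have "(b * x) * x ^ k \<le> s * x ^ k"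
          by (simp add: k ac_simps)
        then show ?thesis
          using xnz mult_le_cancel_semifield by (metis power_not_zero)
      next
        case 2
        \<comment> \<open>All exponents occurring in \<open>p\<close> are at least
          \<open>j + 1\<close>, so the spare factor appears at the small point
          \<open>inverse x\<close>.\<close>
        define y where "y = inverse x"
        have ynz: "y \<noteq> 0" and xy: "x * y = 1"
          using xnz by (simp_all add: y_def inverse_nonzero right_inv)
        have "y \<le> 1"
          using mult_right_mono[OF x, of y] xy by simp
        then have mono: "y ^ i \<le> y ^ k" if "k \<le> i" for i k
          using mult_mono_semifield[OF order_refl[of "y ^ k"] power_mono_semifield[of y 1 "i - k"]]
            that by (simp add: power_add[symmetric])
        have "coeff p i * y ^ i \<le> s * y ^ Suc j" for i
        proof (cases "i \<le> j")
          case False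
          then show ?thesis
            by (intro mult_mono_semifield s mono) simp
        qed (simp add: 2)
        then have "b * y ^ j \<le> s * y ^ Suc j"
          using order_trans[OF b[OF ynz]] poly_le_iff by blast
        then have "b * y ^ j \<le> (s * y) * y ^ j"
          by (simp add: ac_simps)
        then have "b \<le> s * y"
          using ynz mult_le_cancel_semifield by (metis power_not_zero)
        then have "b * x \<le> s * y * x"
          by (simp add: mult_right_mono)
        then show ?thesis
          using xy by (simp add: ac_simps)
      qed
    qed
    have "b = 0"
    proof (rule ccontr)
      assume "b \<noteq> 0"
      then have "x \<le> s * inverse b" if "1 \<le> x" for x
        using bound[OF that] by (simp add: le_mult_inverse_iff mult.commute)
      then show False
        using unbounded by blast
    qed
    then show ?thesis
      by simp
  qed
  then have "isGlb UNIV (poly_quotients p j) (coeff p j)" for j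
    by (simp add: isGlb_poly_quotients_iff)
  then show ?thesis
    by (simp add: closed_poly_def poly_quotients_def)
qed

section \<open>Splitting\<close>

text \<open>Unlike \<open>p\<^sub>j p\<^sub>j\<^sub>+\<^sub>2 \<le> p\<^sub>j\<^sub>+\<^sub>1\<^sup>2\<close>, this form is stable under multiplication by \<open>X + r\<close>.\<close>
definition strongly_log_concave :: "'a::idempotent_semifield poly \<Rightarrow> bool" where
  "strongly_log_concave p \<longleftrightarrow>
     (\<forall>i j. i \<le> j \<longrightarrow> coeff p i * coeff p (Suc j) \<le> coeff p (Suc i) * coeff p j)"

text \<open>Both sides are expanded in powers of \<open>r\<close>. As sums are suprema, the single
  right-hand term \<open>r * (a i * a j)\<close> may dominate both left-hand terms linear in
  \<open>r\<close>; one of these needs the hypothesis at indices \<open>i - 1\<close> and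
  \<open>j\<close>, hence in its non-adjacent form.\<close>

lemma strongly_log_concave_mult_linear:
  fixes p :: "'a::idempotent_semifield poly"
  assumes "strongly_log_concave p"
  shows "strongly_log_concave ([:r, 1:] * p)"
  unfolding strongly_log_concave_def
proof (intro allI impI)
  fix i j :: nat
  assume ij: "i \<le> j"
  define a where "a = coeff p"
  \<comment> \<open>The coefficients of \<open>p\<close> multiplied by the variable.\<close>
  define a' where "a' i = (case i of 0 \<Rightarrow> 0 | Suc k \<Rightarrow> a k)" for i
  have P: "a i * a (Suc j) \<le> a (Suc i) * a j" if "i \<le> j" for i j
    using assms that by (simp add: strongly_log_concave_def a_def)
  have Q: "a' i * a j \<le> a i * a' j" if "i \<le> j" for i j
    using P[of "i - 1" "j - 1"] that by (auto simp: a'_def split: nat.splits)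
  have Q': "a' i * a (Suc j) \<le> a i * a j"
  proof (cases i)
    case (Suc k)
    then show ?thesis
      using P[of k j] ij by (simp add: a'_def)
  qed (simp add: a'_def)
  have c: "coeff ([:r, 1:] * p) k = r * a k + a' k" for k
    by (simp add: a_def a'_def coeff_pCons split: nat.split)
  have S: "a' (Suc k) = a k" for k
    by (simp add: a'_def)
  define rhs where "rhs = (r * a (Suc i) + a i) * (r * a j + a' j)"
  have "r * r * (a (Suc i) * a j) + r * (a (Suc i) * a' j) + r * (a i * a j) + a i * a' j \<le> rhs"
    by (simp add: rhs_def distrib_left distrib_right ac_simps)
  then have le: "r * r * (a (Suc i) * a j) \<le> rhs" "r * (a (Suc i) * a' j) \<le> rhs"
    "r * (a i * a j) \<le> rhs" "a i * a' j \<le> rhs"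
    by (simp_all only: add_le_iff)
  have "r * r * (a i * a (Suc j)) \<le> rhs"
    using mult_left_mono[OF P[OF ij], of "r * r"] le(1) by (simp add: order_trans)
  moreover have "r * (a' i * a (Suc j)) \<le> rhs"
    using mult_left_mono[OF Q', of r] le(3) by (simp add: order_trans)
  moreover have "a' i * a j \<le> rhs"
    using Q[OF ij] le(4) by (rule order_trans)
  ultimately have "(r * a i + a' i) * (r * a (Suc j) + a j) \<le> rhs"
    using le(3) by (simp add: distrib_left distrib_right add_le_iff ac_simps)
  then show "coeff ([:r, 1:] * p) i * coeff ([:r, 1:] * p) (Suc j)
      \<le> coeff ([:r, 1:] * p) (Suc i) * coeff ([:r, 1:] * p) j"
    unfolding c rhs_def S .
qed

lemma splits_imp_strongly_log_concave:
  fixes p :: "'a::idempotent_semifield poly"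
  assumes "splits_poly p"
  shows "strongly_log_concave p"
proof -
  obtain r where r: "p = smult (coeff p (degree p)) (\<Prod>i = 1..degree p. [:r i, 1:])"
    using assms by (auto simp: splits_poly_def)
  have "strongly_log_concave (\<Prod>i = 1..n. [:r i, 1:])" for n
  proof (induction n)
    case 0
    then show ?case
      by (simp add: strongly_log_concave_def)
  next
    case (Suc n)
    have "(\<Prod>i = 1..Suc n. [:r i, 1:]) = [:r (Suc n), 1:] * (\<Prod>i = 1..n. [:r i, 1:])"
      by (simp add: mult.commute)
    then show ?case
      using strongly_log_concave_mult_linear[OF Suc.IH] by metis
  qed
  moreover have "strongly_log_concave (smult a q)" if "strongly_log_concave q" for a and q :: "'a poly"
    unfolding strongly_log_concave_def
  proof (intro allI impI)
    fix i j :: nat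
    assume "i \<le> j"
    then have "(a * a) * (coeff q i * coeff q (Suc j)) \<le> (a * a) * (coeff q (Suc i) * coeff q j)"
      using that by (intro mult_left_mono) (simp_all add: strongly_log_concave_def)
    then show "coeff (smult a q) i * coeff (smult a q) (Suc j)
        \<le> coeff (smult a q) (Suc i) * coeff (smult a q) j"
      by (simp add: ac_simps)
  qed
  ultimately show ?thesis
    by (subst r) blast
qed

text \<open>The non-adjacent inequalities exclude gaps; the adjacent ones alone would admit
  \<open>1 + X^3\<close>.\<close>

lemma strongly_log_concave_imp_ratio:
  fixes p :: "'a::idempotent_semifield poly"
  assumes "strongly_log_concave p" "p \<noteq> 0"
  shows "ratio_condition p"
proof -
  have L: "coeff p i * coeff p (Suc j) \<le> coeff p (Suc i) * coeff p j" if "i \<le> j" for i j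
    using assms(1) that by (simp add: strongly_log_concave_def)
  have "coeff p j \<noteq> 0" if "coeff p i \<noteq> 0" "i \<le> j" "j \<le> degree p" for i j
    using that(2,3)
  proof (induction j rule: dec_induct)
    case base
    then show ?case
      using that(1) by simp
  next
    case (step k)
    then have "k \<le> degree p - 1" "degree p > 0"
      by auto
    \<comment> \<open>The upper pair of indices is taken at the top of \<open>p\<close>, which makes
      the left side nonzero.\<close>
    then have "coeff p k * lead_coeff p \<le> coeff p (Suc k) * coeff p (degree p - 1)"
      using L[of k "degree p - 1"] by simp
    moreover have "coeff p k * lead_coeff p \<noteq> 0"
      using step assms(2) by simp
    ultimately show ?case
      by auto
  qed
  then show ?thesis
    using assms(2) L[of _ "Suc _"] by (auto simp: ratio_condition_def full_support_iff)
qed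

lemma coeff_prod_linear_decreasing:
  fixes c :: "nat \<Rightarrow> 'a::idempotent_semifield"
  assumes "\<And>k. 1 \<le> k \<Longrightarrow> k < n \<Longrightarrow> c (k + 1) \<le> c k"
  shows "coeff (\<Prod>k = 1..n. [:c k, 1:]) m = (if m \<le> n then \<Prod>k = 1..n - m. c k else 0)"
  using assms
proof (induction n arbitrary: m)
  case 0
  then show ?case
    by (cases m) auto
next
  case (Suc n)
  have IH: "coeff (\<Prod>k = 1..n. [:c k, 1:]) m = (if m \<le> n then \<Prod>k = 1..n - m. c k else 0)" for m
    using Suc by simp
  have "(\<Prod>i = 1..Suc n. [:c i, 1:]) = [:c (Suc n), 1:] * (\<Prod>i = 1..n. [:c i, 1:])"
    by (simp add: mult.commute)
  then have eq: "coeff (\<Prod>i = 1..Suc n. [:c i, 1:]) m =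
      c (Suc n) * coeff (\<Prod>i = 1..n. [:c i, 1:]) m +
      (case m of 0 \<Rightarrow> 0 | Suc k \<Rightarrow> coeff (\<Prod>i = 1..n. [:c i, 1:]) k)"
    by (simp add: coeff_pCons split: nat.split)
  show ?case
  proof (cases m)
    case 0
    then show ?thesis
      unfolding eq IH by (simp add: mult.commute)
  next
    case (Suc k)
    consider "n < k" | "k = n" | "k < n"
      by linarith
    then show ?thesis
    proof cases
      case 3
      have "c (Suc n) \<le> c l" if "1 \<le> l" "l \<le> Suc n" for l
        using that(2,1)
      proof (induction rule: inc_induct)
        case (step q)
        then show ?case
          using Suc.prems[of q] by simp
      qed simp
      then have "c (Suc n) \<le> c (n - k)"
        using 3 by simp
      \<comment> \<open>The two contributions to the coefficient differ only in these factors, so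
        the second absorbs the first.\<close>
      then have "c (Suc n) * (\<Prod>i = 1..n - m. c i) \<le> c (n - k) * (\<Prod>i = 1..n - m. c i)"
        by (simp add: mult_right_mono)
      moreover have "n - k = Suc (n - m)"
        using Suc 3 by simp
      ultimately show ?thesis
        unfolding eq IH using Suc 3 by (simp add: le_iff_add_absorb mult.commute)
    qed (use Suc eq IH in auto)
  qed
qed

section \<open>Translation to the quotients \<open>c k\<close>, equivalences and attained
  infimum\<close>

theorem theorem5p4:
  fixes p :: "'a::idempotent_semifield poly" and n :: nat and c :: "nat \<Rightarrow> 'a"
  assumes "infinite (UNIV :: 'a set)"
    and "degree p = n" and "n > 0"
    and "\<And>k. 1 \<le> k \<Longrightarrow> k \<le> n \<Longrightarrow>
           c k = (if coeff p (n - k + 1) \<noteq> 0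
                  then coeff p (n - k) * inverse (coeff p (n - k + 1)) else 0)"
  shows "(closed_poly p \<longleftrightarrow> splits_poly p) \<and>
         (splits_poly p \<longleftrightarrow> concavity_property p) \<and>
         (concavity_property p \<longleftrightarrow>
            full_support p \<and> (\<forall>k. 1 \<le> k \<and> k < n \<longrightarrow> c k \<ge> c (k + 1))) \<and>
         (closed_poly p \<longrightarrow>
            p = smult (coeff p n) (\<Prod>k = 1..n. [:c k, 1:]) \<and>
            (\<forall>j<n. coeff p j ^ (j + 1) = poly p (c (n - j)) * coeff p (j + 1) ^ j) \<and>
            (\<forall>j<n. c (n - j) \<noteq> 0 \<longrightarrow>
               isGlb UNIV {poly p x * inverse (x ^ j) | x. x \<noteq> 0}
                 (poly p (c (n - j)) * inverse (c (n - j) ^ j))))"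
proof -
  have p: "p \<noteq> 0"
    using assms(2,3) by auto
  have c: "c (n - j) = (if coeff p (j + 1) \<noteq> 0
      then coeff p j * inverse (coeff p (j + 1)) else 0)" if "j < n" for j
    using assms(4)[of "n - j"] that by simp
  have supp: "coeff p j \<noteq> 0" if "full_support p" "coeff p i \<noteq> 0" "i \<le> j" "j \<le> n" for i j
    using that full_support_iff[OF p] assms(2) by blast
  \<comment> \<open>This includes \<open>coeff p (j + 1) = 0\<close>, where full support forces
    \<open>coeff p j = 0\<close>, in accordance with the default value of \<open>c\<close>.\<close>
  have c_mult: "coeff p j = coeff p (j + 1) * c (n - j)" if "full_support p" "j < n" for j
    using supp[OF that(1), of j "j + 1"] that(2) c[OF that(2)]
    by (auto simp: mult.left_commute[of _ "coeff p j"] right_inv)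
  have ratio_iff: "coeff p j * coeff p (j + 2) \<le> coeff p (j + 1) * coeff p (j + 1) \<longleftrightarrow>
      c (n - j) \<le> c (n - (j + 1))" if "full_support p" "j + 2 \<le> n" for j
  proof (cases "coeff p (j + 1) = 0")
    case True
    then show ?thesis
      using c_mult[OF that(1), of j] c[of j] that(2) by simp
  next
    case False
    define u v where "u = coeff p (j + 1)" and "v = coeff p (j + 2)"
    have "v \<noteq> 0"
      using supp[OF that(1) False, of "j + 2"] that(2) by (simp add: v_def)
    have "u \<noteq> 0"
      using False by (simp add: u_def)
    have j: "coeff p j = u * c (n - j)" and u: "u = v * c (n - (j + 1))"
      using c_mult[OF that(1), of j] c_mult[OF that(1), of "j + 1"] that(2)
      by (simp_all add: u_def v_def)
    \<comment> \<open>Each side of the ratio inequality is the corresponding \<open>c\<close> times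
      \<open>u * v\<close>.\<close>
    have "coeff p j * v \<le> u * u \<longleftrightarrow> c (n - j) * (u * v) \<le> c (n - (j + 1)) * (u * v)"
      using j u by (metis mult.assoc mult.commute)
    then show ?thesis
      using \<open>u \<noteq> 0\<close> \<open>v \<noteq> 0\<close> mult_le_cancel_semifield[of "u * v"] by (simp add: u_def v_def)
  qed
  have ratio: "ratio_condition p \<longleftrightarrow>
      full_support p \<and> (\<forall>k. 1 \<le> k \<and> k < n \<longrightarrow> c k \<ge> c (k + 1))"
  proof (intro iffI conjI allI impI)
    fix k
    assume R: "ratio_condition p" and k: "1 \<le> k \<and> k < n"
    define j where "j = n - (k + 1)"
    have "n - j = k + 1" "n - (j + 1) = k" "j + 2 \<le> n"
      using k unfolding j_def by linarith+
    then show "c (k + 1) \<le> c k"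
      using ratio_iff[of j] R by (simp add: ratio_condition_def)
  next
    assume R: "full_support p \<and> (\<forall>k. 1 \<le> k \<and> k < n \<longrightarrow> c k \<ge> c (k + 1))"
    have "coeff p j * coeff p (j + 2) \<le> coeff p (j + 1) * coeff p (j + 1)" for j
    proof (cases "j + 2 \<le> n")
      case True
      then have "n - j = n - (j + 1) + 1" "1 \<le> n - (j + 1)" "n - (j + 1) < n"
        by simp_all
      then have "c (n - j) \<le> c (n - (j + 1))"
        using R by metis
      then show ?thesis
        using ratio_iff[of j] R True by blast
    next
      case False
      then show ?thesis
        using assms(2) by (simp add: coeff_eq_0)
    qed
    then show "ratio_condition p"
      using R by (simp add: ratio_condition_def)
  qed (simp add: ratio_condition_def)
  have factors: "p = smult (coeff p n) (\<Prod>k = 1..n. [:c k, 1:])" if R: "ratio_condition p"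
  proof (rule poly_eqI)
    fix m
    \<comment> \<open>Descending from the leading coefficient, \<open>c_mult\<close>
      telescopes.\<close>
    have "coeff p (n - d) = coeff p n * (\<Prod>k = 1..d. c k)" if "d \<le> n" for d
      using that
    proof (induction d)
      case (Suc d)
      then have "coeff p (n - Suc d) = coeff p (n - d) * c (Suc d)"
        using c_mult[of "n - Suc d"] R by (simp add: ratio_condition_def Suc_diff_Suc)
      then show ?case
        using Suc by (simp add: ac_simps)
    qed simp
    from this[of "n - m"]
    have "coeff p m = coeff p n * (if m \<le> n then \<Prod>k = 1..n - m. c k else 0)"
      using assms(2) by (auto simp: coeff_eq_0)
    then show "coeff p m = coeff (smult (coeff p n) (\<Prod>k = 1..n. [:c k, 1:])) m"
      using R ratio coeff_prod_linear_decreasing[of n c m] by simp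
  qed
  have closed_iff: "closed_poly p \<longleftrightarrow> ratio_condition p"
    using closed_imp_concavity concavity_imp_ratio ratio_imp_closed assms(1) p by blast
  have splits_iff: "splits_poly p \<longleftrightarrow> ratio_condition p"
    using splits_imp_strongly_log_concave strongly_log_concave_imp_ratio factors p assms(2)
    by (auto simp: splits_poly_def)
  have concavity_iff: "concavity_property p \<longleftrightarrow> ratio_condition p"
    using concavity_imp_ratio ratio_imp_concavity p by blast
  \<comment> \<open>The value \<open>c (n - j)\<close> is the point \<open>e\<close> of
    \<open>ratio_imp_maximal_term\<close>.\<close>
  have attained: "c (n - j) \<noteq> 0 \<and> poly p (c (n - j)) = coeff p j * c (n - j) ^ j"
    if R: "ratio_condition p" and j: "j < n" "coeff p j \<noteq> 0" for j
  proof
    have "coeff p (j + 1) \<noteq> 0"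
      using c_mult[of j] R j by (metis mult_zero_left ratio_condition_def)
    then show "poly p (c (n - j)) = coeff p j * c (n - j) ^ j"
      using ratio_imp_maximal_term[OF R j(2)] j(1) c[OF j(1)] assms(2) by simp
    show "c (n - j) \<noteq> 0"
      using c_mult[of j] R j by (metis mult_zero_right ratio_condition_def)
  qed
  have "coeff p j ^ (j + 1) = poly p (c (n - j)) * coeff p (j + 1) ^ j"
    if R: "ratio_condition p" and j: "j < n" for j
  proof (cases "coeff p j = 0")
    case True
    \<comment> \<open>For \<open>j = 0\<close> the power of \<open>coeff p (j + 1)\<close> is
      \<open>1\<close>, so the right side must vanish through the value of \<open>p\<close> at
      \<open>0\<close>, which is the constant coefficient.\<close>
    then have "c (n - j) = 0"
      using c[OF j] by simp
    moreover have "coeff p 0 = 0"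
      using supp[of 0 j] R True j by (auto simp: ratio_condition_def)
    ultimately show ?thesis
      using True by (simp add: poly_0_coeff_0)
  next
    case False
    have "coeff p j = coeff p (j + 1) * c (n - j)"
      using c_mult[of j] R j by (simp add: ratio_condition_def)
    then have "coeff p j ^ j = c (n - j) ^ j * coeff p (j + 1) ^ j"
      by (metis power_mult_distrib mult.commute)
    then show ?thesis
      using attained[OF R j False] by (simp add: mult.assoc)
  qed
  moreover have "isGlb UNIV {poly p x * inverse (x ^ j) | x. x \<noteq> 0}
      (poly p (c (n - j)) * inverse (c (n - j) ^ j))"
    if R: "ratio_condition p" and j: "j < n" "c (n - j) \<noteq> 0" for j
  proof -
    have "coeff p j \<noteq> 0"
      using j c[of j] by (metis mult_zero_left)
    then have "poly p (c (n - j)) * inverse (c (n - j) ^ j) = coeff p j"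
      using attained[OF R j(1)] j(2) by (simp add: mult.assoc right_inv)
    then show ?thesis
      using closed_iff R by (simp add: closed_poly_def)
  qed
  ultimately show ?thesis
    using closed_iff splits_iff concavity_iff ratio factors by blast
qed

end
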